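(* Let $G$ be a group and let $\kappa$ be an infinite regular cardinal with $|G|=\kappa$. Then the following statements hold: (i) for each $m\in\mathbb{N}$, each $(\kappa,m)$-thin subset $A$ of $G$ is a union of at most $m$ $(\kappa,1)$-thin subsets of $G$; (ii) the ideal (in the Boolean algebra of all subsets of $G$) generated by the family of $(\kappa,1)$-thin subsets of $G$ coincides with the family of all subsets of $G$ that are $(\kappa,m)$-thin for some $m\in\mathbb{N}$.
   Context: $\mathbb{N}=\{1,2,\dots\}$. For a group $G$ and cardinals $\kappa,\mu$ with $|G|\geqslant\kappa\geqslant\aleph_0$ and $\mu\leqslant\kappa$, put $[G]^{<\kappa}=\{X\subset G: |X|<\kappa\}$. A subset $A\subseteq G$ is $(\kappa,\mu)$-thin if for every $F\in[G]^{<\kappa}$ there exists $K\in[G]^{<\kappa}$ such that $|Fg\cap A|\leqslant\mu$ for each $g\in G\setminus K$, where $Fg=\{fg: f\in F\}$. *)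

theory Defs
  imports "HOL-Algebra.Coset" "HOL.Hull"
begin

unbundle cardinal_syntax

text \<open>Cardinals are cardinal orders: \<open>\<kappa>\<close> and \<open>\<mu>\<close> are relations over arbitrary types, compared by
  \<open><o\<close>, \<open>\<le>o\<close> and \<open>=o\<close>. The finite cardinal \<open>m\<close> is \<open>natLeq_on m\<close>.\<close>

definition small_subsets :: "'a set \<Rightarrow> 'k rel \<Rightarrow> 'a set set" where
  "small_subsets X \<kappa> = {Y. Y \<subseteq> X \<and> |Y| <o \<kappa>}"

definition thin :: "('a, 'b) monoid_scheme \<Rightarrow> 'k rel \<Rightarrow> 'm rel \<Rightarrow> 'a set \<Rightarrow> bool" where
  "thin G \<kappa> \<mu> A \<longleftrightarrow> A \<subseteq> carrier G \<and>
     (\<forall>F \<in> small_subsets (carrier G) \<kappa>. \<exists>K \<in> small_subsets (carrier G) \<kappa>.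
        \<forall>g \<in> carrier G - K. |(F #>\<^bsub>G\<^esub> g) \<inter> A| \<le>o \<mu>)"

text \<open>Ideals in the Boolean algebra of all subsets of \<open>X\<close>; the improper ideal \<open>Pow X\<close> is admitted, so
  that every family of subsets of \<open>X\<close> generates one.\<close>

definition set_ideal :: "'a set \<Rightarrow> 'a set set \<Rightarrow> bool" where
  "set_ideal X I \<longleftrightarrow> I \<subseteq> Pow X \<and> {} \<in> I \<and>
     (\<forall>A \<in> I. \<forall>B. B \<subseteq> A \<longrightarrow> B \<in> I) \<and> (\<forall>A \<in> I. \<forall>B \<in> I. A \<union> B \<in> I)"

definition generated_ideal :: "'a set \<Rightarrow> 'a set set \<Rightarrow> 'a set set" where
  "generated_ideal X S = set_ideal X hull S"

end

theory Submission
  imports Defs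
begin

text \<open>
  Call a set small if it has fewer than \<open>\<kappa>\<close> elements. Both parts rest on splitting a
  \<open>(\<kappa>, m)\<close>-thin set \<open>A\<close> into \<open>m\<close> classes that are \<open>(\<kappa>, 1)\<close>-thin (\<open>thin_split\<close>), and this is a
  graph colouring problem. Regularity of \<open>\<kappa> = |G|\<close> gives a chain \<open>\<E>\<close> of small subsets of \<open>G\<close> such
  that every small subset lies in a member of \<open>\<E>\<close> (\<open>cofinal_chain_of_small_subsets\<close>).
  For each \<open>E \<in> \<E>\<close> thinness provides a small exceptional set \<open>K E\<close> with \<open>|E a \<inter> A| \<le> m\<close> for
  \<open>a \<notin> K E\<close>. Join two distinct points \<open>a, b\<close> of \<open>A\<close> when, for some \<open>E \<in> \<E>\<close> containing \<open>\<one>\<close>, both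
  lie outside \<open>K E\<close> and \<open>a \<in> E b\<close>, \<open>b \<in> E a\<close>. A vertex \<open>a\<close> that has a neighbour lies, together with
  all its neighbours, in the union of the sets \<open>E a \<inter> A\<close> taken over the \<open>E\<close> with \<open>a \<notin> K E\<close>. These
  sets form a chain and have at most \<open>m\<close> elements each, so their union has at most \<open>m\<close> elements as
  well: every degree is less than \<open>m\<close>. A greedy colouring along a well-order hence uses only \<open>m\<close>
  colours (\<open>proper_colouring_if_degree_less\<close>).

  A colour class \<open>B\<close> is \<open>(\<kappa>, 1)\<close>-thin: for a small \<open>F\<close>, pick \<open>E \<in> \<E>\<close> containing \<open>\<one>\<close> and all
  quotients of elements of \<open>F\<close>. Two distinct points of \<open>F g \<inter> B\<close> would be joined unless one of them
  is in \<open>K E\<close>, which happens only for \<open>g\<close> in the small set \<open>F\<inverse> (K E)\<close> (\<open>thin_1I\<close>).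

  The description of the ideal follows: the union of an \<open>(\<kappa>, m)\<close>-thin and a \<open>(\<kappa>, n)\<close>-thin set is
  \<open>(\<kappa>, m + n)\<close>-thin, and conversely the splitting exhibits each \<open>(\<kappa>, m)\<close>-thin set as a finite union
  of generators.
\<close>

lemma card_of_ordLeq_natLeq_on_iff:
  "|A| \<le>o natLeq_on n \<longleftrightarrow> finite A \<and> card A \<le> n"
proof
  assume "|A| \<le>o natLeq_on n"
  then have "|A| \<le>o |{x. x < n}|"
    using card_of_mono2[of "|A|" "natLeq_on n"] by (simp add: Field_natLeq_on Field_card_of)
  then obtain f where f: "inj_on f A" "f ` A \<subseteq> {x. x < n}"
    using card_of_ordLeq[of A "{x. x < n}"] by blast
  show "finite A \<and> card A \<le> n"
    using card_inj_on_le[OF f] inj_on_finite[OF f] by simp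
next
  assume "finite A \<and> card A \<le> n"
  then obtain f where "f ` A \<subseteq> {x. x < n}" "inj_on f A"
    using card_le_inj[of A "{x. x < n}"] by auto
  then have "|A| \<le>o |{x. x < n}|"
    using card_of_ordLeq by blast
  then show "|A| \<le>o natLeq_on n"
    using card_of_least[OF natLeq_on_well_order_on] ordLeq_transitive by blast
qed

lemma thin_natLeq_on_iff:
  "thin G \<kappa> (natLeq_on m) A \<longleftrightarrow> A \<subseteq> carrier G \<and>
     (\<forall>F \<in> small_subsets (carrier G) \<kappa>. \<exists>K \<in> small_subsets (carrier G) \<kappa>.
        \<forall>g \<in> carrier G - K. finite ((F #>\<^bsub>G\<^esub> g) \<inter> A) \<and> card ((F #>\<^bsub>G\<^esub> g) \<inter> A) \<le> m)"
  unfolding thin_def card_of_ordLeq_natLeq_on_iff ..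


section \<open>Small subsets\<close>

lemma small_subsets_mono:
  assumes "Y \<in> small_subsets X \<kappa>" and "Z \<subseteq> Y"
  shows "Z \<in> small_subsets X \<kappa>"
  using assms unfolding small_subsets_def
  by (auto intro: ordLeq_ordLess_trans[OF card_of_mono1])

lemma small_subsets_image:
  assumes "Y \<in> small_subsets X \<kappa>" and "f ` Y \<subseteq> Z"
  shows "f ` Y \<in> small_subsets Z \<kappa>"
  using assms unfolding small_subsets_def
  by (auto intro: ordLeq_ordLess_trans[OF card_of_image])

lemma small_subsets_Un:
  assumes "Card_order \<kappa>" and "infinite (Field \<kappa>)"
    and "Y \<in> small_subsets X \<kappa>" and "Z \<in> small_subsets X \<kappa>"
  shows "Y \<union> Z \<in> small_subsets X \<kappa>"
  using assms card_of_Un_ordLess_infinite_Field[of \<kappa> Y Z] unfolding small_subsets_def by auto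

lemma small_subsets_finite:
  assumes "Card_order \<kappa>" and "infinite (Field \<kappa>)" and "finite Y" and "Y \<subseteq> X"
  shows "Y \<in> small_subsets X \<kappa>"
proof -
  have "|Y| <o \<kappa>"
    by (rule finite_ordLess_infinite)
      (use assms card_of_Well_order[of Y] in
        \<open>simp_all add: card_order_on_well_order_on Field_card_of\<close>)
  then show ?thesis
    using assms by (simp add: small_subsets_def)
qed

lemma small_subsets_Times:
  fixes X :: "'a set" and X' :: "'b set"
  assumes card: "Card_order \<kappa>" and inf: "infinite (Field \<kappa>)"
    and Y: "Y \<in> small_subsets X \<kappa>" and Z: "Z \<in> small_subsets X' \<kappa>"
  shows "Y \<times> Z \<in> small_subsets (X \<times> X') \<kappa>"
proof -
  (* An infinite set is equipotent to its square, so it is enough to embed the product into the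
     square of one small set. *)
  let ?S = "Y <+> Z"
  have S: "?S \<in> small_subsets UNIV \<kappa>"
    using card_of_Plus_ordLess_infinite_Field[OF inf card, of Y Z] Y Z
    by (simp add: small_subsets_def)
  have "?S \<times> ?S \<in> small_subsets UNIV \<kappa>"
  proof (cases "finite ?S")
    case True
    then show ?thesis
      by (intro small_subsets_finite[OF card inf]) auto
  next
    case False
    then show ?thesis
      using S ordIso_ordLess_trans[OF card_of_Times_same_infinite[OF False]]
      by (simp add: small_subsets_def)
  qed
  moreover define P :: "(('a + 'b) \<times> ('a + 'b)) set" where "P = Inl ` Y \<times> Inr ` Z"
  moreover have "P \<subseteq> ?S \<times> ?S"
    by (auto simp: P_def)
  ultimately have "P \<in> small_subsets UNIV \<kappa>"
    using small_subsets_mono by blast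
  moreover have P: "Y \<times> Z = (\<lambda>(p, q). (projl p, projr q)) ` P"
    by (force simp: P_def)
  moreover have "Y \<times> Z \<subseteq> X \<times> X'"
    using Y Z by (auto simp: small_subsets_def)
  ultimately show ?thesis
    using small_subsets_image by metis
qed

lemma small_subsets_image2:
  assumes "Card_order \<kappa>" and "infinite (Field \<kappa>)"
    and "Y \<in> small_subsets X \<kappa>" and "Z \<in> small_subsets X' \<kappa>"
    and "\<And>y z. y \<in> Y \<Longrightarrow> z \<in> Z \<Longrightarrow> f y z \<in> W"
  shows "(\<lambda>(y, z). f y z) ` (Y \<times> Z) \<in> small_subsets W \<kappa>"
proof (rule small_subsets_image)
  show "Y \<times> Z \<in> small_subsets (X \<times> X') \<kappa>"
    by (rule small_subsets_Times[OF assms(1-4)])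
qed (use assms(5) in auto)

text \<open>The chain consists of the images of the initial segments of \<open>\<kappa>\<close> under a bijection with \<open>X\<close>.
  Regularity says precisely that a small set of indices is bounded, so each small set is caught.\<close>

lemma cofinal_chain_of_small_subsets:
  assumes card: "Card_order \<kappa>" and inf: "infinite (Field \<kappa>)" and reg: "regularCard \<kappa>"
    and X: "|X| =o \<kappa>"
  obtains \<E> where "\<E> \<subseteq> small_subsets X \<kappa>"
    and "\<And>E E'. E \<in> \<E> \<Longrightarrow> E' \<in> \<E> \<Longrightarrow> E \<subseteq> E' \<or> E' \<subseteq> E"
    and "\<And>F. F \<in> small_subsets X \<kappa> \<Longrightarrow> \<exists>E \<in> \<E>. F \<subseteq> E"
proof -
  have wo: "Well_order \<kappa>"
    using card by (simp add: card_order_on_def)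
  have total: "(i, j) \<in> \<kappa> \<or> (j, i) \<in> \<kappa>" if "i \<in> Field \<kappa>" "j \<in> Field \<kappa>" for i j
    using wo_rel.TOTALS[unfolded wo_rel_def, OF wo] that by blast
  have "|X| =o |Field \<kappa>|"
    using X card_of_Field_ordIso[OF card] ordIso_symmetric ordIso_transitive by blast
  then obtain h where h: "bij_betw h X (Field \<kappa>)"
    using card_of_ordIso by blast
  define E where "E i = {x \<in> X. (h x, i) \<in> \<kappa>}" for i
  show ?thesis
  proof
    show "E ` Field \<kappa> \<subseteq> small_subsets X \<kappa>"
    proof clarify
      fix i assume i: "i \<in> Field \<kappa>"
      have "under \<kappa> i \<subseteq> underS \<kappa> i \<union> {i}"
        by (auto simp: under_def underS_def)
      moreover have "underS \<kappa> i \<union> {i} \<in> small_subsets UNIV \<kappa>"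
        using small_subsets_Un[OF card inf, of "underS \<kappa> i" UNIV "{i}"]
          card_of_underS[OF card i] small_subsets_finite[OF card inf, of "{i}" UNIV]
        by (simp add: small_subsets_def)
      ultimately have "under \<kappa> i \<in> small_subsets UNIV \<kappa>"
        by (rule small_subsets_mono[rotated])
      moreover have E: "E i = inv_into X h ` under \<kappa> i"
      proof (intro equalityI subsetI)
        fix x assume "x \<in> E i"
        then have "x \<in> X" "h x \<in> under \<kappa> i"
          by (simp_all add: E_def under_def)
        then show "x \<in> inv_into X h ` under \<kappa> i"
          using bij_betw_inv_into_left[OF h] by (metis imageI)
      next
        fix x assume "x \<in> inv_into X h ` under \<kappa> i"
        then obtain j where j: "(j, i) \<in> \<kappa>" "x = inv_into X h j"
          by (auto simp: under_def)
        have "j \<in> Field \<kappa>"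
          using j(1) by (rule FieldI1)
        then show "x \<in> E i"
          using j bij_betw_inv_into_right[OF h] bij_betwE[OF bij_betw_inv_into[OF h]]
          by (simp add: E_def)
      qed
      moreover have "E i \<subseteq> X"
        by (auto simp: E_def)
      ultimately show "E i \<in> small_subsets X \<kappa>"
        using small_subsets_image by metis
    qed
  next
    have mono: "E i \<subseteq> E j" if "(i, j) \<in> \<kappa>" for i j
      using transD[OF wo_rel.TRANS[unfolded wo_rel_def, OF wo] _ that] unfolding E_def by blast
    fix A B assume "A \<in> E ` Field \<kappa>" "B \<in> E ` Field \<kappa>"
    then obtain i j where ij: "i \<in> Field \<kappa>" "j \<in> Field \<kappa>" "A = E i" "B = E j"
      by blast
    then show "A \<subseteq> B \<or> B \<subseteq> A"
      using mono[of i j] mono[of j i] total[of i j] by auto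
  next
    fix F assume F: "F \<in> small_subsets X \<kappa>"
    have hF: "h ` F \<subseteq> Field \<kappa>"
      using F h by (auto simp: small_subsets_def bij_betw_def)
    have "|h ` F| <o \<kappa>"
      using small_subsets_image[OF F, of h UNIV] by (simp add: small_subsets_def)
    then have "\<not> cofinal (h ` F) \<kappa>"
      using reg hF not_ordLess_ordIso unfolding regularCard_def by blast
    then obtain i where i: "i \<in> Field \<kappa>" "\<And>j. j \<in> h ` F \<Longrightarrow> i = j \<or> (i, j) \<notin> \<kappa>"
      unfolding cofinal_def by blast
    have "(j, i) \<in> \<kappa>" if "j \<in> h ` F" for j
      using total[of i j] i(1) i(2)[OF that] hF that by auto
    then have "F \<subseteq> E i"
      using F by (auto simp: E_def small_subsets_def)
    then show "\<exists>E \<in> E ` Field \<kappa>. F \<subseteq> E"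
      using i(1) by blast
  qed
qed


section \<open>Chains of bounded finite sets and greedy colouring\<close>

text \<open>A member of maximal size is comparable to all others, hence contains them: the union of the
  chain is one of its members.\<close>

lemma finite_card_Union_chain_le:
  assumes chain: "\<And>C D. C \<in> \<C> \<Longrightarrow> D \<in> \<C> \<Longrightarrow> C \<subseteq> D \<or> D \<subseteq> C"
    and bound: "\<And>C. C \<in> \<C> \<Longrightarrow> finite C \<and> card C \<le> m"
  shows "finite (\<Union>\<C>) \<and> card (\<Union>\<C>) \<le> m"
proof (cases "\<C> = {}")
  case False
  then obtain C0 where "C0 \<in> \<C>"
    by blast
  moreover have "\<forall>D. D \<in> \<C> \<longrightarrow> card D < Suc m"
    using bound by (simp add: less_Suc_eq_le)
  ultimately have "\<exists>C. C \<in> \<C> \<and> (\<forall>D. D \<in> \<C> \<longrightarrow> card D \<le> card C)"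
    by (rule Lattices_Big.ex_has_greatest_nat)
  then obtain C where C: "C \<in> \<C>" and max: "\<And>D. D \<in> \<C> \<Longrightarrow> card D \<le> card C"
    by blast
  have "D \<subseteq> C" if "D \<in> \<C>" for D
    using chain[OF C that] card_seteq[of D C] max[OF that] bound[OF that] by auto
  then have "\<Union>\<C> = C"
    using C by blast
  then show ?thesis
    using bound[OF C] by simp
qed simp

text \<open>Going along a well-order of the vertices, fewer than \<open>m\<close> neighbours are coloured before a given
  vertex, so one of \<open>m\<close> colours is still free for it.\<close>

lemma proper_colouring_if_degree_less:
  fixes adj :: "'a \<Rightarrow> 'a \<Rightarrow> bool" and m :: nat
  assumes sym: "\<And>x y. adj x y \<Longrightarrow> adj y x" and irrefl: "\<And>x. \<not> adj x x"
    and degree: "\<And>x. finite {y. adj x y} \<and> card {y. adj x y} < m"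
  obtains c :: "'a \<Rightarrow> nat" where "\<And>x. c x < m" and "\<And>x y. adj x y \<Longrightarrow> c x \<noteq> c y"
proof -
  obtain r :: "'a rel" where r: "Well_order r" "Field r = UNIV"
    using well_ordering[where 'a = 'a] by (elim exE conjE)
  define R where "R = r - Id"
  have wf: "wf R"
    using r(1) by (simp add: R_def well_order_on_def)
  have total: "(x, y) \<in> R \<or> (y, x) \<in> R" if "x \<noteq> y" for x y
    using wo_rel.TOTALS[unfolded wo_rel_def, OF r(1)] r(2) that unfolding R_def by auto
  define before where "before x = {y. adj x y \<and> (y, x) \<in> R}" for x
  define c :: "'a \<Rightarrow> nat" where
    "c = wfrec R (\<lambda>f x. LEAST i. i \<notin> f ` before x)"
  have c: "c x = (LEAST i. i \<notin> c ` before x)" for x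
  proof -
    have "cut c R x ` before x = c ` before x"
      by (rule image_cong) (auto simp: before_def cut_def)
    with def_wfrec[OF eq_reflection[OF c_def] wf, of x] show ?thesis
      by (simp only:)
  qed
  have bounded_fresh: "c x < m \<and> c x \<notin> c ` before x" for x
  proof -
    have sub: "before x \<subseteq> {y. adj x y}"
      by (auto simp: before_def)
    have fin: "finite (before x)"
      using finite_subset[OF sub] degree[of x] by simp
    have "card (before x) < m"
      using card_mono[OF _ sub] degree[of x] by (meson le_less_trans)
    then have "card (c ` before x) < card {..<m}"
      using card_image_le[OF fin, of c] by simp
    then have "\<not> {..<m} \<subseteq> c ` before x"
      using fin card_mono[of "c ` before x" "{..<m}"] by auto
    then obtain i where "i < m" "i \<notin> c ` before x"
      by auto
    then show ?thesis
      using LeastI[of "\<lambda>i. i \<notin> c ` before x" i] Least_le[of "\<lambda>i. i \<notin> c ` before x" i]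
      by (simp flip: c)
  qed
  show ?thesis
  proof
    show "c x < m" for x
      using bounded_fresh by simp
    show "c x \<noteq> c y" if "adj x y" for x y
    proof -
      have "y \<in> before x \<or> x \<in> before y"
        using that sym[OF that] irrefl[of x] total[of x y] by (auto simp: before_def)
      then show ?thesis
        using bounded_fresh[of x] bounded_fresh[of y] by (metis imageI)
    qed
  qed
qed


section \<open>Splitting thin sets\<close>

text \<open>Two points of one translate \<open>F g\<close> differ by a quotient of elements of \<open>F\<close>, and a point of
  \<open>F g\<close> lies in an exceptional set \<open>L\<close> only for \<open>g\<close> in the small set \<open>F\<inverse> L\<close>. So
  \<open>(\<kappa>, 1)\<close>-thinness reduces to excluding, outside a small set, pairs of points related by a given
  small set of quotients.\<close>

lemma thin_1I:
  fixes G (structure)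
  assumes "group G" and card: "Card_order \<kappa>" and inf: "infinite (Field \<kappa>)"
    and B: "B \<subseteq> carrier G"
    and sep: "\<And>Q. Q \<in> small_subsets (carrier G) \<kappa> \<Longrightarrow>
      \<exists>L \<in> small_subsets (carrier G) \<kappa>. \<forall>a \<in> B - L. \<forall>b \<in> B - L.
        a \<in> Q #> b \<and> b \<in> Q #> a \<longrightarrow> a = b"
  shows "thin G \<kappa> (natLeq_on 1) B"
  unfolding thin_natLeq_on_iff
proof (intro conjI ballI B)
  interpret group G by fact
  fix F assume F: "F \<in> small_subsets (carrier G) \<kappa>"
  then have FG: "F \<subseteq> carrier G"
    by (simp add: small_subsets_def)
  define Q where "Q = (\<lambda>(f, f'). f \<otimes> inv f') ` (F \<times> F)"
  have "Q \<in> small_subsets (carrier G) \<kappa>"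
    unfolding Q_def by (rule small_subsets_image2[OF card inf F F]) (use FG in auto)
  then obtain L where L: "L \<in> small_subsets (carrier G) \<kappa>"
    and sepL: "\<And>a b. a \<in> B - L \<Longrightarrow> b \<in> B - L \<Longrightarrow> a \<in> Q #> b \<Longrightarrow> b \<in> Q #> a \<Longrightarrow> a = b"
    using sep by blast
  then have LG: "L \<subseteq> carrier G"
    by (simp add: small_subsets_def)
  define K where "K = (\<lambda>(f, k). inv f \<otimes> k) ` (F \<times> L)"
  have K: "K \<in> small_subsets (carrier G) \<kappa>"
    unfolding K_def by (rule small_subsets_image2[OF card inf F L]) (use FG LG in auto)
  show "\<exists>K \<in> small_subsets (carrier G) \<kappa>.
    \<forall>g \<in> carrier G - K. finite ((F #> g) \<inter> B) \<and> card ((F #> g) \<inter> B) \<le> 1"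
  proof (intro bexI[OF _ K] ballI)
    fix g assume g: "g \<in> carrier G - K"
    have notL: "f \<otimes> g \<notin> L" if "f \<in> F" for f
    proof
      assume "f \<otimes> g \<in> L"
      moreover have "g = inv f \<otimes> (f \<otimes> g)"
        using that FG g by (auto simp flip: m_assoc)
      ultimately have "g \<in> K"
        using that unfolding K_def by force
      then show False
        using g by simp
    qed
    have quotient: "f \<otimes> g \<in> Q #> (f' \<otimes> g)" if "f \<in> F" "f' \<in> F" for f f'
    proof -
      have "f \<in> carrier G" "f' \<in> carrier G" "g \<in> carrier G"
        using that FG g by auto
      then have "f \<otimes> g = f \<otimes> inv f' \<otimes> (f' \<otimes> g)"
        by (simp add: m_assoc inv_solve_left)
      then show ?thesis
        using that unfolding Q_def r_coset_def by force
    qed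
    have "a = b" if "a \<in> (F #> g) \<inter> B" "b \<in> (F #> g) \<inter> B" for a b
    proof -
      obtain f f' where "f \<in> F" "f' \<in> F" "a = f \<otimes> g" "b = f' \<otimes> g"
        using \<open>a \<in> _\<close> \<open>b \<in> _\<close> by (auto simp: r_coset_def)
      then show ?thesis
        using that notL quotient by (intro sepL) auto
    qed
    then have "(F #> g) \<inter> B = {} \<or> (\<exists>a. (F #> g) \<inter> B = {a})"
      by blast
    then show "finite ((F #> g) \<inter> B) \<and> card ((F #> g) \<inter> B) \<le> 1"
      by auto
  qed
qed

text \<open>The colouring argument: the classes of the splitting are the colour classes of a graph whose
  edges are the close pairs that lie outside the exceptional sets.\<close>

lemma thin_split:
  fixes G (structure)
  assumes "group G" and card: "Card_order \<kappa>" and inf: "infinite (Field \<kappa>)"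
    and reg: "regularCard \<kappa>" and G: "|carrier G| =o \<kappa>"
    and m: "m \<ge> 1" and thinA: "thin G \<kappa> (natLeq_on m) A"
  shows "\<exists>\<B>. finite \<B> \<and> card \<B> \<le> m \<and> (\<forall>B \<in> \<B>. thin G \<kappa> (natLeq_on 1) B) \<and> A = \<Union>\<B>"
proof -
  interpret group G by fact
  have AG: "A \<subseteq> carrier G"
    using thinA by (simp add: thin_def)
  obtain \<E> where small: "\<E> \<subseteq> small_subsets (carrier G) \<kappa>"
    and chain: "\<And>E E'. E \<in> \<E> \<Longrightarrow> E' \<in> \<E> \<Longrightarrow> E \<subseteq> E' \<or> E' \<subseteq> E"
    and cof: "\<And>F. F \<in> small_subsets (carrier G) \<kappa> \<Longrightarrow> \<exists>E \<in> \<E>. F \<subseteq> E"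
    using cofinal_chain_of_small_subsets[OF card inf reg G] by blast
  have "\<forall>E \<in> \<E>. \<exists>K \<in> small_subsets (carrier G) \<kappa>.
      \<forall>g \<in> carrier G - K. finite ((E #> g) \<inter> A) \<and> card ((E #> g) \<inter> A) \<le> m"
    using thinA small unfolding thin_natLeq_on_iff by blast
  then obtain K where K: "\<And>E. E \<in> \<E> \<Longrightarrow> K E \<in> small_subsets (carrier G) \<kappa>"
    and bound: "\<And>E g. E \<in> \<E> \<Longrightarrow> g \<in> carrier G - K E \<Longrightarrow>
      finite ((E #> g) \<inter> A) \<and> card ((E #> g) \<inter> A) \<le> m"
    by metis
  define adj where "adj a b \<longleftrightarrow> a \<noteq> b \<and> (\<exists>E \<in> \<E>. \<one> \<in> E \<and>
      a \<in> A - K E \<and> b \<in> A - K E \<and> a \<in> E #> b \<and> b \<in> E #> a)" for a b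
  have degree: "finite {b. adj a b} \<and> card {b. adj a b} < m" for a
  proof (cases "{b. adj a b} = {}")
    case True
    then show ?thesis
      using m by simp
  next
    case False
    then have a: "a \<in> A"
      by (auto simp: adj_def)
    define \<C> where "\<C> = (\<lambda>E. (E #> a) \<inter> A) ` {E \<in> \<E>. a \<notin> K E}"
    have "finite (\<Union>\<C>) \<and> card (\<Union>\<C>) \<le> m"
    proof (rule finite_card_Union_chain_le)
      show "C \<subseteq> D \<or> D \<subseteq> C" if "C \<in> \<C>" "D \<in> \<C>" for C D
        using that chain unfolding \<C>_def r_coset_def by blast
      show "finite C \<and> card C \<le> m" if "C \<in> \<C>" for C
        using that bound a AG unfolding \<C>_def by auto
    qed
    (* The degree is below m, and not just at most m, because the vertex a itself lies in the union;
       this is what the condition \<one> \<in> E in the definition of adj secures. *)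
    moreover have sub: "insert a {b. adj a b} \<subseteq> \<Union>\<C>"
    proof -
      have "{b. adj a b} \<subseteq> \<Union>\<C>"
        unfolding adj_def \<C>_def by blast
      moreover obtain E where "E \<in> \<E>" "\<one> \<in> E" "a \<notin> K E"
        using False unfolding adj_def by blast
      moreover have "a = \<one> \<otimes> a"
        using a AG by auto
      ultimately show ?thesis
        using a unfolding \<C>_def r_coset_def by blast
    qed
    ultimately have fin: "finite {b. adj a b}" and "card (insert a {b. adj a b}) \<le> m"
      using finite_subset[OF sub] card_mono[OF _ sub] by auto
    moreover have "a \<notin> {b. adj a b}"
      by (simp add: adj_def)
    ultimately show ?thesis
      by simp
  qed
  have "adj b a" if "adj a b" for a b
    using that unfolding adj_def by blast
  moreover have "\<not> adj a a" for a
    by (simp add: adj_def)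
  ultimately obtain c :: "'a \<Rightarrow> nat" where c: "\<And>a. c a < m" "\<And>a b. adj a b \<Longrightarrow> c a \<noteq> c b"
    using proper_colouring_if_degree_less[of adj m] degree by blast
  define colour_class where "colour_class i = {a \<in> A. c a = i}" for i
  have thin_class: "thin G \<kappa> (natLeq_on 1) (colour_class i)" for i
  proof (rule thin_1I[OF \<open>group G\<close> card inf])
    show "colour_class i \<subseteq> carrier G"
      using AG by (auto simp: colour_class_def)
    fix Q assume "Q \<in> small_subsets (carrier G) \<kappa>"
    then have "Q \<union> {\<one>} \<in> small_subsets (carrier G) \<kappa>"
      by (intro small_subsets_Un[OF card inf]) (auto intro: small_subsets_finite[OF card inf])
    then obtain E where E: "E \<in> \<E>" "Q \<subseteq> E" "\<one> \<in> E"
      using cof by blast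
    have "a = b" if ab: "a \<in> colour_class i - K E" "b \<in> colour_class i - K E"
      "a \<in> Q #> b" "b \<in> Q #> a" for a b
    proof (rule ccontr)
      assume "a \<noteq> b"
      then have "adj a b"
        using ab E unfolding adj_def colour_class_def r_coset_def by blast
      then show False
        using c(2)[of a b] ab by (simp add: colour_class_def)
    qed
    then show "\<exists>L \<in> small_subsets (carrier G) \<kappa>. \<forall>a \<in> colour_class i - L.
      \<forall>b \<in> colour_class i - L. a \<in> Q #> b \<and> b \<in> Q #> a \<longrightarrow> a = b"
      using K[OF E(1)] by blast
  qed
  show ?thesis
  proof (intro exI conjI)
    show "finite (colour_class ` {..<m})"
      by simp
    show "card (colour_class ` {..<m}) \<le> m"
      using card_image_le[of "{..<m}" colour_class] by simp
    show "A = \<Union>(colour_class ` {..<m})"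
      using c(1) by (auto simp: colour_class_def)
    show "\<forall>B \<in> colour_class ` {..<m}. thin G \<kappa> (natLeq_on 1) B"
      using thin_class by blast
  qed
qed


section \<open>The ideal of finitely thin sets\<close>

lemma thin_subset:
  assumes "thin G \<kappa> (natLeq_on m) A" and "B \<subseteq> A"
  shows "thin G \<kappa> (natLeq_on m) B"
  unfolding thin_natLeq_on_iff
proof (intro conjI ballI)
  show "B \<subseteq> carrier G"
    using assms by (auto simp: thin_def)
  fix F assume "F \<in> small_subsets (carrier G) \<kappa>"
  then obtain K where K: "K \<in> small_subsets (carrier G) \<kappa>"
    and bound: "\<And>g. g \<in> carrier G - K \<Longrightarrow>
      finite ((F #>\<^bsub>G\<^esub> g) \<inter> A) \<and> card ((F #>\<^bsub>G\<^esub> g) \<inter> A) \<le> m"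
    using assms(1) unfolding thin_natLeq_on_iff by blast
  have sub: "(F #>\<^bsub>G\<^esub> g) \<inter> B \<subseteq> (F #>\<^bsub>G\<^esub> g) \<inter> A" for g
    using assms(2) by blast
  show "\<exists>K \<in> small_subsets (carrier G) \<kappa>. \<forall>g \<in> carrier G - K.
      finite ((F #>\<^bsub>G\<^esub> g) \<inter> B) \<and> card ((F #>\<^bsub>G\<^esub> g) \<inter> B) \<le> m"
    using K bound finite_subset[OF sub] card_mono[OF _ sub] by (meson le_trans)
qed

lemma thin_Un:
  assumes card: "Card_order \<kappa>" and inf: "infinite (Field \<kappa>)"
    and A: "thin G \<kappa> (natLeq_on m) A" and B: "thin G \<kappa> (natLeq_on n) B"
  shows "thin G \<kappa> (natLeq_on (m + n)) (A \<union> B)"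
  unfolding thin_natLeq_on_iff
proof (intro conjI ballI)
  show "A \<union> B \<subseteq> carrier G"
    using A B by (auto simp: thin_def)
  fix F assume F: "F \<in> small_subsets (carrier G) \<kappa>"
  obtain K where K: "K \<in> small_subsets (carrier G) \<kappa>" "\<And>g. g \<in> carrier G - K \<Longrightarrow>
      finite ((F #>\<^bsub>G\<^esub> g) \<inter> A) \<and> card ((F #>\<^bsub>G\<^esub> g) \<inter> A) \<le> m"
    using A F unfolding thin_natLeq_on_iff by blast
  obtain L where L: "L \<in> small_subsets (carrier G) \<kappa>" "\<And>g. g \<in> carrier G - L \<Longrightarrow>
      finite ((F #>\<^bsub>G\<^esub> g) \<inter> B) \<and> card ((F #>\<^bsub>G\<^esub> g) \<inter> B) \<le> n"
    using B F unfolding thin_natLeq_on_iff by blast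
  show "\<exists>K \<in> small_subsets (carrier G) \<kappa>. \<forall>g \<in> carrier G - K.
      finite ((F #>\<^bsub>G\<^esub> g) \<inter> (A \<union> B)) \<and> card ((F #>\<^bsub>G\<^esub> g) \<inter> (A \<union> B)) \<le> m + n"
  proof (intro bexI[OF _ small_subsets_Un[OF card inf K(1) L(1)]] ballI)
    fix g assume "g \<in> carrier G - (K \<union> L)"
    then show "finite ((F #>\<^bsub>G\<^esub> g) \<inter> (A \<union> B)) \<and> card ((F #>\<^bsub>G\<^esub> g) \<inter> (A \<union> B)) \<le> m + n"
      using K(2)[of g] L(2)[of g]
        card_Un_le[of "(F #>\<^bsub>G\<^esub> g) \<inter> A" "(F #>\<^bsub>G\<^esub> g) \<inter> B"]
      by (simp add: Int_Un_distrib)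
  qed
qed

lemma set_ideal_thin:
  assumes card: "Card_order \<kappa>" and inf: "infinite (Field \<kappa>)"
  shows "set_ideal (carrier G) {A. \<exists>m::nat. m \<ge> 1 \<and> thin G \<kappa> (natLeq_on m) A}"
  unfolding set_ideal_def
proof (intro conjI ballI allI impI)
  show "{A. \<exists>m::nat. m \<ge> 1 \<and> thin G \<kappa> (natLeq_on m) A} \<subseteq> Pow (carrier G)"
    by (auto simp: thin_def)
  have "{} \<in> small_subsets (carrier G) \<kappa>"
    by (rule small_subsets_finite[OF card inf]) auto
  then have "thin G \<kappa> (natLeq_on 1) {}"
    unfolding thin_natLeq_on_iff by auto
  then show "{} \<in> {A. \<exists>m::nat. m \<ge> 1 \<and> thin G \<kappa> (natLeq_on m) A}"
    by blast
next
  fix A B assume "A \<in> {A. \<exists>m::nat. m \<ge> 1 \<and> thin G \<kappa> (natLeq_on m) A}" "B \<subseteq> A"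
  then show "B \<in> {A. \<exists>m::nat. m \<ge> 1 \<and> thin G \<kappa> (natLeq_on m) A}"
    using thin_subset by blast
next
  fix A B assume "A \<in> {A. \<exists>m::nat. m \<ge> 1 \<and> thin G \<kappa> (natLeq_on m) A}"
    and "B \<in> {A. \<exists>m::nat. m \<ge> 1 \<and> thin G \<kappa> (natLeq_on m) A}"
  then obtain m n :: nat where "m \<ge> 1" "thin G \<kappa> (natLeq_on m) A" "thin G \<kappa> (natLeq_on n) B"
    by blast
  then have "m + n \<ge> 1" "thin G \<kappa> (natLeq_on (m + n)) (A \<union> B)"
    using thin_Un[OF card inf] by auto
  then show "A \<union> B \<in> {A. \<exists>m::nat. m \<ge> 1 \<and> thin G \<kappa> (natLeq_on m) A}"
    by blast
qed

lemma set_ideal_finite_Union: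
  assumes I: "set_ideal X I" and "finite \<B>" and "\<B> \<subseteq> I"
  shows "\<Union>\<B> \<in> I"
  using assms(2,3)
proof (induction rule: finite_induct)
  case empty
  then show ?case
    using I by (simp add: set_ideal_def)
next
  case (insert B \<B>)
  then show ?case
    using I unfolding set_ideal_def by simp
qed

theorem theorem2:
  fixes G :: "('a, 'b) monoid_scheme" and \<kappa> :: "'k rel"
  assumes "group G"
    and "Card_order \<kappa>" and "infinite (Field \<kappa>)" and "regularCard \<kappa>"
    and "|carrier G| =o \<kappa>"
  shows "(\<forall>m::nat. \<forall>A. m \<ge> 1 \<longrightarrow> thin G \<kappa> (natLeq_on m) A \<longrightarrow>
           (\<exists>\<B>. finite \<B> \<and> card \<B> \<le> m \<and> (\<forall>B \<in> \<B>. thin G \<kappa> (natLeq_on 1) B) \<and> A = \<Union>\<B>))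
       \<and> generated_ideal (carrier G) {A. thin G \<kappa> (natLeq_on 1) A}
           = {A. \<exists>m::nat. m \<ge> 1 \<and> thin G \<kappa> (natLeq_on m) A}"
proof (intro conjI)
  show split: "\<forall>m::nat. \<forall>A. m \<ge> 1 \<longrightarrow> thin G \<kappa> (natLeq_on m) A \<longrightarrow>
      (\<exists>\<B>. finite \<B> \<and> card \<B> \<le> m \<and> (\<forall>B \<in> \<B>. thin G \<kappa> (natLeq_on 1) B) \<and> A = \<Union>\<B>)"
    by (intro allI impI thin_split[OF assms])
  show "generated_ideal (carrier G) {A. thin G \<kappa> (natLeq_on 1) A}
      = {A. \<exists>m::nat. m \<ge> 1 \<and> thin G \<kappa> (natLeq_on m) A}"
    unfolding generated_ideal_def
  proof (rule hull_unique)
    show "{A. thin G \<kappa> (natLeq_on 1) A} \<subseteq> {A. \<exists>m::nat. m \<ge> 1 \<and> thin G \<kappa> (natLeq_on m) A}"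
      by blast
    show "set_ideal (carrier G) {A. \<exists>m::nat. m \<ge> 1 \<and> thin G \<kappa> (natLeq_on m) A}"
      by (rule set_ideal_thin[OF assms(2,3)])
    fix I assume gens: "{A. thin G \<kappa> (natLeq_on 1) A} \<subseteq> I" and I: "set_ideal (carrier G) I"
    show "{A. \<exists>m::nat. m \<ge> 1 \<and> thin G \<kappa> (natLeq_on m) A} \<subseteq> I"
    proof clarify
      fix A and m :: nat assume "m \<ge> 1" "thin G \<kappa> (natLeq_on m) A"
      then obtain \<B> where "finite \<B>" "\<forall>B \<in> \<B>. thin G \<kappa> (natLeq_on 1) B" "A = \<Union>\<B>"
        using split by blast
      then show "A \<in> I"
        using gens set_ideal_finite_Union[OF I, of \<B>] by blast
    qed
  qed
qed

end
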